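(* Let $n \ge 1$, let $A \in M_n(\mathbb{C})$ be a normal matrix and let $D \in M_n(\mathbb{C})$ be a density matrix. Then $$\mathrm{Tr}\,\bigl[D\,|A - \mathrm{Tr}[DA]\, I_n|^4\bigr] \;\le\; \frac{4}{27}\,\mathrm{spd}(A)^4 .$$ Moreover, if $A$ is Hermitian, then $$\mathrm{Tr}\,\bigl[D\,|A - \mathrm{Tr}[DA]\, I_n|^4\bigr] \;\le\; \frac{\mathrm{spd}(A)^4}{12} .$$
   Context: $M_n(\mathbb{C})$ is the algebra of $n\times n$ complex matrices, $I_n$ is the identity matrix, and $\mathrm{Tr}$ is the usual trace. A density matrix is a positive semidefinite matrix $D$ with $\mathrm{Tr}\,D = 1$. For $B \in M_n(\mathbb{C})$, $|B| = (B^*B)^{1/2}$. The spread of $A$ is $\mathrm{spd}(A) = \max_{i,j} |\lambda_i(A) - \lambda_j(A)|$, where $\lambda_1(A),\dots,\lambda_n(A)$ are the eigenvalues of $A$. *)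

theory Defs
  imports "Jordan_Normal_Form.Schur_Decomposition" "Jordan_Normal_Form.Spectral_Radius"
begin

definition mat_trace :: "'a::comm_monoid_add mat \<Rightarrow> 'a" where
  "mat_trace A = (\<Sum>i<dim_row A. A $$ (i, i))"

definition normal_mat :: "complex mat \<Rightarrow> bool" where
  "normal_mat A \<longleftrightarrow> square_mat A \<and> A * mat_adjoint A = mat_adjoint A * A"

definition hermitian_mat :: "complex mat \<Rightarrow> bool" where
  "hermitian_mat A \<longleftrightarrow> square_mat A \<and> mat_adjoint A = A"

(* The order on complex numbers is the one of Complex_Order:
   z \<le> w iff Re z \<le> Re w and Im z = Im w. *)
definition psd_mat :: "complex mat \<Rightarrow> bool" where
  "psd_mat A \<longleftrightarrow> hermitian_mat A \<and>
     (\<forall>v \<in> carrier_vec (dim_row A). 0 \<le> (A *\<^sub>v v) \<bullet>c v)"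

definition density_mat :: "complex mat \<Rightarrow> bool" where
  "density_mat D \<longleftrightarrow> psd_mat D \<and> mat_trace D = 1"

(* Meaningful for positive semidefinite A, where the positive semidefinite
   square root exists and is unique. *)
definition mat_sqrt :: "complex mat \<Rightarrow> complex mat" where
  "mat_sqrt A = (THE P. psd_mat P \<and> P * P = A)"

definition mat_abs :: "complex mat \<Rightarrow> complex mat" where
  "mat_abs B = mat_sqrt (mat_adjoint B * B)"

definition spread :: "complex mat \<Rightarrow> real" where
  "spread A = Max {cmod (x - y) | x y. x \<in> spectrum A \<and> y \<in> spectrum A}"

end

theory Submission
  imports Defs
begin

text \<open>
  Diagonalising \<open>A = U diag(z) U\<^sup>*\<close> and taking the diagonal of \<open>U\<^sup>* D U\<close> as weights, the trace
  becomes the fourth absolute central moment \<open>M\<close> of a random variable \<open>X\<close> supported on the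
  eigenvalues. Let \<open>Y\<close> be an independent copy of \<open>X\<close>, \<open>C\<close> the \<open>2 \<times> 2\<close> covariance matrix of \<open>X\<close>
  as a planar vector, \<open>V = tr C\<close> and \<open>d\<close> the spread. Expanding both sides of
  \<open>E |X - Y|\<^sup>4 \<le> d\<^sup>2 E |X - Y|\<^sup>2\<close> gives \<open>2 M + 2 V\<^sup>2 + 4 tr C\<^sup>2 \<le> 2 d\<^sup>2 V\<close>. In the plane
  \<open>tr C\<^sup>2 \<ge> V\<^sup>2 / 2\<close>, so \<open>M \<le> d\<^sup>2 V - 2 V\<^sup>2 \<le> d\<^sup>4 / 8\<close>, which is below \<open>4 d\<^sup>4 / 27\<close>; on the real
  line \<open>tr C\<^sup>2 = V\<^sup>2\<close>, so \<open>M \<le> d\<^sup>2 V - 3 V\<^sup>2 \<le> d\<^sup>4 / 12\<close>.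
\<close>

section \<open>Fourth central moments of finite distributions\<close>

text \<open>The points have weighted mean zero and \<open>a\<close>, \<open>b\<close>,
  \<open>c\<close> are the entries of their covariance matrix C, so the last bracket is tr C^2. The
  averages of |X - Y|^4 and |X - Y|^2 are computed by averaging over \<open>j\<close> first and then
  over \<open>i\<close>.\<close>

lemma planar_fourth_moment_bound:
  fixes p x y :: "nat \<Rightarrow> real"
  assumes p0: "\<And>i. i < n \<Longrightarrow> 0 \<le> p i" and p1: "(\<Sum>i<n. p i) = 1"
    and mx: "(\<Sum>i<n. p i * x i) = 0" and my: "(\<Sum>i<n. p i * y i) = 0"
    and d: "\<And>i j. i < n \<Longrightarrow> j < n \<Longrightarrow> (x i - x j)^2 + (y i - y j)^2 \<le> d^2"
  defines "a \<equiv> \<Sum>i<n. p i * (x i)^2" and "b \<equiv> \<Sum>i<n. p i * (y i)^2"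
    and "c \<equiv> \<Sum>i<n. p i * (x i * y i)"
  shows "(\<Sum>i<n. p i * ((x i)^2 + (y i)^2)^2)
           \<le> d^2 * (a + b) - (a + b)^2 - 2 * (a^2 + 2 * c^2 + b^2)"
proof -
  define r where "r i = (x i)^2 + (y i)^2" for i
  define m where "m = (\<Sum>i<n. p i * (r i)^2)"
  \<comment> \<open>Third moments: they enter through the average over \<open>j\<close> but vanish
    in the average over \<open>i\<close>, where they multiply the zero means.\<close>
  define u where "u = (\<Sum>i<n. p i * (r i * x i))"
  define v where "v = (\<Sum>i<n. p i * (r i * y i))"
  define s where "s i j = (x i - x j)^2 + (y i - y j)^2" for i j
  have rr: "(\<Sum>i<n. p i * r i) = a + b"
    unfolding r_def a_def b_def by (simp add: sum.distrib algebra_simps)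
  have inner2: "(\<Sum>j<n. p j * s i j) = r i + (a + b)" for i
  proof -
    have "(\<Sum>j<n. p j * s i j) =
      (\<Sum>j<n. r i * p j + p j * r j - (2 * x i) * (p j * x j) - (2 * y i) * (p j * y j))"
      unfolding s_def r_def by (rule sum.cong) (auto simp: power2_eq_square algebra_simps)
    also have "\<dots> = r i + (a + b)"
      unfolding sum.distrib sum_subtractf sum_distrib_left[symmetric] p1 mx my rr by simp
    finally show ?thesis .
  qed
  have inner4: "(\<Sum>j<n. p j * (s i j)^2) = (r i)^2 + m + 2 * r i * (a + b)
      + 4 * ((x i)^2 * a + 2 * (x i * y i) * c + (y i)^2 * b) - 4 * (x i * u + y i * v)" for i
  proof -
    \<comment> \<open>Every term becomes a factor free of \<open>j\<close> times the summand of a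
      known moment, so that \<open>sum_distrib_left\<close> read backwards can pull the factor
      out.\<close>
    have "(\<Sum>j<n. p j * (s i j)^2) =
      (\<Sum>j<n. (r i)^2 * p j + p j * (r j)^2 + (2 * r i) * (p j * r j)
         + (4 * (x i)^2) * (p j * (x j)^2) + (8 * (x i * y i)) * (p j * (x j * y j))
         + (4 * (y i)^2) * (p j * (y j)^2)
         - (4 * r i * x i) * (p j * x j) - (4 * r i * y i) * (p j * y j)
         - (4 * x i) * (p j * (r j * x j)) - (4 * y i) * (p j * (r j * y j)))"
    proof (rule sum.cong)
      fix j
      have s: "s i j = r i + r j - 2 * (x i * x j + y i * y j)"
        unfolding s_def r_def by (simp add: power2_eq_square algebra_simps)
      show "p j * (s i j)^2 = (r i)^2 * p j + p j * (r j)^2 + (2 * r i) * (p j * r j)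
         + (4 * (x i)^2) * (p j * (x j)^2) + (8 * (x i * y i)) * (p j * (x j * y j))
         + (4 * (y i)^2) * (p j * (y j)^2)
         - (4 * r i * x i) * (p j * x j) - (4 * r i * y i) * (p j * y j)
         - (4 * x i) * (p j * (r j * x j)) - (4 * y i) * (p j * (r j * y j))"
        unfolding s by (simp add: power2_eq_square algebra_simps)
    qed simp
    also have "\<dots> = (r i)^2 + m + 2 * r i * (a + b)
      + 4 * ((x i)^2 * a + 2 * (x i * y i) * c + (y i)^2 * b) - 4 * (x i * u + y i * v)"
      unfolding sum.distrib sum_subtractf sum_distrib_left[symmetric] p1 mx my rr
        a_def[symmetric] b_def[symmetric] c_def[symmetric] m_def[symmetric]
        u_def[symmetric] v_def[symmetric]
      by (simp add: algebra_simps)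
    finally show ?thesis .
  qed
  have "(\<Sum>i<n. p i * (\<Sum>j<n. p j * (s i j)^2)) =
    (\<Sum>i<n. p i * (r i)^2 + m * p i + (2 * (a + b)) * (p i * r i)
       + (4 * a) * (p i * (x i)^2) + (8 * c) * (p i * (x i * y i)) + (4 * b) * (p i * (y i)^2)
       - (4 * u) * (p i * x i) - (4 * v) * (p i * y i))"
    unfolding inner4 by (rule sum.cong) (auto simp: algebra_simps)
  also have "\<dots> = 2 * m + 2 * (a + b)^2 + 4 * (a^2 + 2 * c^2 + b^2)"
    unfolding sum.distrib sum_subtractf sum_distrib_left[symmetric] p1 mx my rr
      a_def[symmetric] b_def[symmetric] c_def[symmetric] m_def[symmetric]
    by (simp add: power2_eq_square algebra_simps)
  finally have e4: "(\<Sum>i<n. p i * (\<Sum>j<n. p j * (s i j)^2))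
    = 2 * m + 2 * (a + b)^2 + 4 * (a^2 + 2 * c^2 + b^2)" .
  have "(\<Sum>i<n. p i * (\<Sum>j<n. p j * s i j)) = (\<Sum>i<n. p i * r i + (a + b) * p i)"
    unfolding inner2 by (rule sum.cong) (auto simp: algebra_simps)
  also have "\<dots> = 2 * (a + b)"
    unfolding sum.distrib sum_distrib_left[symmetric] p1 rr by simp
  finally have e2: "(\<Sum>i<n. p i * (\<Sum>j<n. p j * s i j)) = 2 * (a + b)" .
  \<comment> \<open>The one estimate of the lemma: 0 <= s <= d^2 gives s^2 <= d^2 s for each pair of
    points. The rest consists of identities.\<close>
  have "(\<Sum>i<n. p i * (\<Sum>j<n. p j * (s i j)^2)) \<le> (\<Sum>i<n. p i * (\<Sum>j<n. p j * (d^2 * s i j)))"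
  proof (intro sum_mono mult_left_mono)
    fix i j assume "i \<in> {..<n}" "j \<in> {..<n}"
    hence "s i j \<le> d^2" "0 \<le> s i j" using d by (auto simp: s_def)
    thus "(s i j)^2 \<le> d^2 * s i j" by (simp add: power2_eq_square mult_right_mono)
  qed (use p0 in auto)
  also have "\<dots> = d^2 * (\<Sum>i<n. p i * (\<Sum>j<n. p j * s i j))"
    by (simp add: sum_distrib_left algebra_simps)
  finally have "m \<le> d^2 * (a + b) - (a + b)^2 - 2 * (a^2 + 2 * c^2 + b^2)"
    unfolding e4 e2 by (simp add: algebra_simps)
  thus ?thesis unfolding m_def r_def .
qed

lemma complex_fourth_central_moment_le:
  fixes p :: "nat \<Rightarrow> real" and z :: "nat \<Rightarrow> complex"
  assumes p0: "\<And>i. i < n \<Longrightarrow> 0 \<le> p i" and p1: "(\<Sum>i<n. p i) = 1"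
    and d: "\<And>i j. i < n \<Longrightarrow> j < n \<Longrightarrow> cmod (z i - z j) \<le> d"
  defines "\<mu> \<equiv> \<Sum>i<n. of_real (p i) * z i"
  shows "(\<Sum>i<n. p i * cmod (z i - \<mu>) ^ 4) \<le> d ^ 4 / 8"
    and "(\<And>i. i < n \<Longrightarrow> Im (z i) = 0) \<Longrightarrow> (\<Sum>i<n. p i * cmod (z i - \<mu>) ^ 4) \<le> d ^ 4 / 12"
proof -
  define x where "x i = Re (z i - \<mu>)" for i
  define y where "y i = Im (z i - \<mu>)" for i
  have "(\<Sum>i<n. p i * x i) = (\<Sum>i<n. p i * Re (z i) - Re \<mu> * p i)"
    by (rule sum.cong) (auto simp: x_def algebra_simps)
  hence mx: "(\<Sum>i<n. p i * x i) = 0"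
    unfolding sum_subtractf sum_distrib_left[symmetric] p1 by (simp add: \<mu>_def)
  have "(\<Sum>i<n. p i * y i) = (\<Sum>i<n. p i * Im (z i) - Im \<mu> * p i)"
    by (rule sum.cong) (auto simp: y_def algebra_simps)
  hence my: "(\<Sum>i<n. p i * y i) = 0"
    unfolding sum_subtractf sum_distrib_left[symmetric] p1 by (simp add: \<mu>_def)
  have dd: "(x i - x j)^2 + (y i - y j)^2 \<le> d^2" if "i < n" "j < n" for i j
  proof -
    have "(x i - x j)^2 + (y i - y j)^2 = cmod (z i - z j)^2"
      by (simp add: x_def y_def cmod_power2)
    also have "\<dots> \<le> d^2" using d[OF that] by (intro power_mono) auto
    finally show ?thesis .
  qed
  have q: "cmod (z i - \<mu>) ^ 4 = ((x i)^2 + (y i)^2)^2" for i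
  proof -
    have "cmod (z i - \<mu>) ^ 4 = (cmod (z i - \<mu>) ^ 2)^2" by simp
    thus ?thesis by (simp only: cmod_power2 x_def y_def)
  qed
  define a where "a = (\<Sum>i<n. p i * (x i)^2)"
  define b where "b = (\<Sum>i<n. p i * (y i)^2)"
  define c where "c = (\<Sum>i<n. p i * (x i * y i))"
  note bound = planar_fourth_moment_bound[OF p0 p1 mx my dd,
    folded q a_def b_def c_def, simplified]
  \<comment> \<open>The right side is 8 times the gap in the next inequality. With V = a + b, the
    first square vanishes at V = d^2/4, the maximiser of d^2 V - 2 V^2; the other two terms add up
    to 16 (tr C^2 - V^2/2).\<close>
  have "0 \<le> (d^2 - 4 * (a + b))^2 + 8 * (a - b)^2 + 32 * c^2" by simp
  hence "d^2 * (a + b) - (a + b)^2 - 2 * (a^2 + 2 * c^2 + b^2) \<le> (d^2)^2 / 8"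
    by (simp add: power2_eq_square algebra_simps)
  with bound show "(\<Sum>i<n. p i * cmod (z i - \<mu>) ^ 4) \<le> d ^ 4 / 8" by simp
  assume re: "\<And>i. i < n \<Longrightarrow> Im (z i) = 0"
  hence "y i = 0" if "i < n" for i
    using that by (simp add: y_def \<mu>_def)
  hence "b = 0" "c = 0" by (simp_all add: b_def c_def)
  \<comment> \<open>The square is 12 times the gap in the next inequality and vanishes at the
    maximiser a = d^2/6 of d^2 a - 3 a^2.\<close>
  moreover have "0 \<le> (d^2 - 6 * a)^2" by simp
  hence "d^2 * a - a^2 - 2 * a^2 \<le> (d^2)^2 / 12"
    by (simp add: power2_eq_square algebra_simps)
  ultimately show "(\<Sum>i<n. p i * cmod (z i - \<mu>) ^ 4) \<le> d ^ 4 / 12"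
    using bound by simp
qed

section \<open>Adjoints and unitary matrices\<close>

lemma mat_adjoint_dim [simp]:
  "dim_row (mat_adjoint A) = dim_col A" "dim_col (mat_adjoint A) = dim_row A"
  unfolding mat_adjoint_def by auto

lemma mat_adjoint_carrier [simp]:
  "A \<in> carrier_mat n m \<Longrightarrow> mat_adjoint A \<in> carrier_mat m n"
  unfolding carrier_mat_def by simp

lemma mat_adjoint_index [simp]:
  "i < dim_col A \<Longrightarrow> j < dim_row A \<Longrightarrow> mat_adjoint A $$ (i, j) = conjugate (A $$ (j, i))"
  unfolding mat_adjoint_def by (simp add: mat_of_rows_index)

lemma mat_adjoint_adjoint [simp]: "mat_adjoint (mat_adjoint A) = A"
  by (rule eq_matI) auto

lemma mat_adjoint_mult:
  fixes A B :: "complex mat"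
  assumes "A \<in> carrier_mat n m" "B \<in> carrier_mat m k"
  shows "mat_adjoint (A * B) = mat_adjoint B * mat_adjoint A"
  using assms by (intro eq_matI) (auto simp: scalar_prod_def mult.commute)

lemma mat_adjoint_mat_diag [simp]:
  "mat_adjoint (mat_diag n f) = mat_diag n (\<lambda>i. cnj (f i))"
  by (rule eq_matI) (auto simp: mat_diag_def)

definition unitary_mat :: "nat \<Rightarrow> complex mat \<Rightarrow> bool" where
  "unitary_mat n U \<longleftrightarrow> U \<in> carrier_mat n n \<and>
     mat_adjoint U * U = 1\<^sub>m n \<and> U * mat_adjoint U = 1\<^sub>m n"

text \<open>A left inverse of a square matrix is also a right inverse, so one of the two equations
  suffices.\<close>

lemma unitary_matI:
  assumes "U \<in> carrier_mat n n" "mat_adjoint U * U = 1\<^sub>m n"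
  shows "unitary_mat n U"
  using assms mat_mult_left_right_inverse[of "mat_adjoint U" n U]
  unfolding unitary_mat_def by auto

lemma unitary_mat_carrier [simp]: "unitary_mat n U \<Longrightarrow> U \<in> carrier_mat n n"
  unfolding unitary_mat_def by simp

text \<open>Products are reassociated to the right below, so cancellation is needed with a trailing
  factor \<open>X\<close>.\<close>

lemma unitary_cancel:
  assumes "unitary_mat n U" "X \<in> carrier_mat n m"
  shows "mat_adjoint U * (U * X) = X" "U * (mat_adjoint U * X) = X"
  using assms unfolding unitary_mat_def
  by (simp_all add: assoc_mult_mat[of _ n n _ n _ m, symmetric])

lemma unitary_mult:
  assumes U: "unitary_mat n U" and V: "unitary_mat n V"
  shows "unitary_mat n (U * V)"
proof (rule unitary_matI)
  have "mat_adjoint (U * V) * (U * V) = mat_adjoint V * (mat_adjoint U * (U * V))"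
    using U V by (simp add: mat_adjoint_mult[of _ n n _ n] assoc_mult_mat[of _ n n _ n _ n]
        mult_carrier_mat[of _ n n _ n])
  also have "\<dots> = 1\<^sub>m n"
    using V unitary_cancel[OF U unitary_mat_carrier[OF V]] by (simp add: unitary_mat_def)
  finally show "mat_adjoint (U * V) * (U * V) = 1\<^sub>m n" .
qed (use U V in \<open>auto intro!: mult_carrier_mat[of _ n n]\<close>)

lemma unitary_conj_inverse:
  assumes U: "unitary_mat n U" and A: "A \<in> carrier_mat n n"
  shows "U * (mat_adjoint U * A * U) * mat_adjoint U = A"
proof -
  have "U * (mat_adjoint U * A * U) * mat_adjoint U
      = U * (mat_adjoint U * (A * (U * mat_adjoint U)))"
    using U A by (simp add: assoc_mult_mat[of _ n n _ n _ n] mult_carrier_mat[of _ n n _ n])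
  thus ?thesis using U A unitary_cancel(2)[OF U A]
    by (simp add: unitary_mat_def right_mult_one_mat[of _ n n])
qed

lemma unitary_conj_mult:
  assumes U: "unitary_mat n U" and A: "A \<in> carrier_mat n n" and B: "B \<in> carrier_mat n n"
  shows "(mat_adjoint U * A * U) * (mat_adjoint U * B * U) = mat_adjoint U * (A * B) * U"
proof -
  have "(mat_adjoint U * A * U) * (mat_adjoint U * B * U)
      = mat_adjoint U * (A * (U * (mat_adjoint U * (B * U))))"
    using U A B by (simp add: assoc_mult_mat[of _ n n _ n _ n] mult_carrier_mat[of _ n n _ n])
  also have "U * (mat_adjoint U * (B * U)) = B * U"
    using U B by (intro unitary_cancel[of n _ _ n] mult_carrier_mat[of _ n n _ n]) auto
  finally show ?thesis
    using U A B by (simp add: assoc_mult_mat[of _ n n _ n _ n] mult_carrier_mat[of _ n n _ n])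
qed

lemma mat_adjoint_unitary_conj:
  assumes U: "unitary_mat n U" and A: "A \<in> carrier_mat n n"
  shows "mat_adjoint (mat_adjoint U * A * U) = mat_adjoint U * mat_adjoint A * U"
  using U A by (simp add: assoc_mult_mat[of _ n n _ n _ n] mult_carrier_mat[of _ n n _ n]
      mat_adjoint_mult[of _ n n _ n])

text \<open>Matrices of the form \<open>udiag n U f\<close> with \<open>U\<close> fixed form the functional calculus of a
  normal matrix.\<close>

definition udiag :: "nat \<Rightarrow> complex mat \<Rightarrow> (nat \<Rightarrow> complex) \<Rightarrow> complex mat" where
  "udiag n U f = U * mat_diag n f * mat_adjoint U"

lemma udiag_carrier [simp]: "unitary_mat n U \<Longrightarrow> udiag n U f \<in> carrier_mat n n"
  unfolding udiag_def
  by (meson mat_adjoint_carrier mat_diag_dim mult_carrier_mat unitary_mat_carrier)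

lemma udiag_mult:
  assumes U: "unitary_mat n U"
  shows "udiag n U f * udiag n U g = udiag n U (\<lambda>i. f i * g i)"
proof -
  have "udiag n U f * udiag n U g =
    U * (mat_diag n f * (mat_adjoint U * (U * (mat_diag n g * mat_adjoint U))))"
    using U unfolding udiag_def
    by (simp add: assoc_mult_mat[of _ n n _ n _ n] mult_carrier_mat[of _ n n _ n])
  also have "mat_adjoint U * (U * (mat_diag n g * mat_adjoint U)) = mat_diag n g * mat_adjoint U"
    using U by (intro unitary_cancel[of n _ _ n] mult_carrier_mat[of _ n n _ n]) auto
  also have "mat_diag n f * (mat_diag n g * mat_adjoint U)
      = mat_diag n (\<lambda>i. f i * g i) * mat_adjoint U"
    using U by (simp add: assoc_mult_mat[of _ n n _ n _ n, symmetric])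
  finally show ?thesis
    using U unfolding udiag_def by (simp add: assoc_mult_mat[of _ n n _ n _ n])
qed

lemma mat_adjoint_udiag:
  assumes U: "unitary_mat n U"
  shows "mat_adjoint (udiag n U f) = udiag n U (\<lambda>i. cnj (f i))"
  using U unfolding udiag_def
  by (simp add: mat_adjoint_mult[of _ n n _ n] assoc_mult_mat[of _ n n _ n _ n]
      mult_carrier_mat[of _ n n _ n])

lemma udiag_const:
  assumes U: "unitary_mat n U"
  shows "udiag n U (\<lambda>i. c) = c \<cdot>\<^sub>m 1\<^sub>m n"
proof -
  have "mat_diag n (\<lambda>i. c) = c \<cdot>\<^sub>m 1\<^sub>m n" by (rule eq_matI) (auto simp: mat_diag_def)
  hence "udiag n U (\<lambda>i. c) = c \<cdot>\<^sub>m (U * mat_adjoint U)"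
    using U unfolding udiag_def
    by (simp add: mult_smult_distrib[of _ n n _ n] mult_smult_assoc_mat[of _ n n _ n]
        right_mult_one_mat[of _ n n])
  thus ?thesis using U by (simp add: unitary_mat_def)
qed

lemma udiag_diff:
  assumes U: "unitary_mat n U"
  shows "udiag n U f - udiag n U g = udiag n U (\<lambda>i. f i - g i)"
proof -
  have "mat_diag n (\<lambda>i. f i - g i) = mat_diag n f - mat_diag n g"
    by (rule eq_matI) (auto simp: mat_diag_def)
  thus ?thesis using U unfolding udiag_def
    by (simp add: mult_minus_distrib_mat[of _ n n _ n] minus_mult_distrib_mat[of _ n n _ _ n]
        mult_carrier_mat[of _ n n _ n])
qed

lemma udiag_pow:
  assumes U: "unitary_mat n U"
  shows "udiag n U f ^\<^sub>m k = udiag n U (\<lambda>i. f i ^ k)"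
proof (induction k)
  case 0
  have "1 \<cdot>\<^sub>m 1\<^sub>m n = (1\<^sub>m n :: complex mat)" by (rule eq_matI) auto
  thus ?case using U carrier_matD(1)[OF udiag_carrier[OF U, of f]] by (simp add: udiag_const)
next
  case (Suc k)
  thus ?case using U by (simp add: udiag_mult mult.commute)
qed

lemma udiag_conj:
  assumes U: "unitary_mat n U"
  shows "mat_adjoint U * udiag n U f * U = mat_diag n f"
proof -
  have "mat_adjoint U * udiag n U f * U = mat_adjoint U * (U * (mat_diag n f * (mat_adjoint U * U)))"
    using U unfolding udiag_def
    by (simp add: assoc_mult_mat[of _ n n _ n _ n] mult_carrier_mat[of _ n n _ n])
  also have "\<dots> = mat_diag n f"
    using U unitary_cancel(1)[OF U, of "mat_diag n f" n]
    by (simp add: unitary_mat_def right_mult_one_mat[of _ n n])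
  finally show ?thesis .
qed

lemma udiag_index:
  assumes U: "unitary_mat n U" and ij: "i < n" "j < n"
  shows "udiag n U f $$ (i, j) = (\<Sum>k = 0..<n. U $$ (i, k) * f k * cnj (U $$ (j, k)))"
  using unitary_mat_carrier[OF U] ij unfolding udiag_def
  by (simp add: mat_diag_mult_right[of _ n n] scalar_prod_def)

lemma udiag_udiag:
  assumes U: "unitary_mat n U" and W: "unitary_mat n W"
  shows "U * udiag n W f * mat_adjoint U = udiag n (U * W) f"
  using U W unfolding udiag_def
  by (simp add: mat_adjoint_mult[of _ n n _ n] assoc_mult_mat[of _ n n _ n _ n]
      mult_carrier_mat[of _ n n _ n])

section \<open>The spectral theorem for normal matrices\<close>

text \<open>Complete \<open>v\<close> to a basis and apply Gram-Schmidt, which keeps the first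
  vector; the normalised results are the columns of \<open>U\<close>.\<close>

lemma unitary_first_col:
  fixes v :: "complex vec"
  assumes v: "v \<in> carrier_vec n" and v0: "v \<noteq> 0\<^sub>v n" and n: "n \<noteq> 0"
  shows "\<exists>U c. unitary_mat n U \<and> col U 0 = c \<cdot>\<^sub>v v"
proof -
  interpret cof_vec_space n "TYPE(complex)" .
  define b where "b = basis_completion v"
  define ws where "ws = gram_schmidt n b"
  from basis_completion[OF v v0, folded b_def]
  have dist_b: "distinct b" and indep: "\<not> lin_dep (set b)" and b: "set b \<subseteq> carrier_vec n"
    and hdb: "hd b = v" and len_b: "length b = n" by auto
  from hdb len_b n obtain vs where bv: "b = v # vs" by (cases b) auto
  from gram_schmidt_result[OF b dist_b indep refl, folded ws_def]
  have ws: "set ws \<subseteq> carrier_vec n" "corthogonal ws" "length ws = n"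
    by (auto simp: len_b)
  from gram_schmidt_hd[OF v, of vs, folded bv] have "hd ws = v" unfolding ws_def .
  hence ws0: "ws ! 0 = v" using ws(3) n by (cases ws) auto
  have wsi: "ws ! i \<in> carrier_vec n" if "i < n" for i
    using ws that by (metis nth_mem subsetD)
  \<comment> \<open>The vectors \<open>ws\<close> are orthogonal but not normalised;
    \<open>r i\<close> is the norm of \<open>ws ! i\<close>, nonzero because
    \<open>corthogonal\<close> excludes vectors with zero self-product.\<close>
  define r where "r i = sqrt (Re (ws ! i \<bullet>c ws ! i))" for i
  have r: "ws ! i \<bullet>c ws ! i = complex_of_real (r i) * r i" "r i \<noteq> 0" if "i < n" for i
  proof -
    have nz: "ws ! i \<bullet>c ws ! i \<noteq> 0" using corthogonalD[OF ws(2), of i i] ws(3) that by auto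
    have ge: "0 \<le> ws ! i \<bullet>c ws ! i" by (rule conjugate_square_ge_0_vec)
    hence "complex_of_real (Re (ws ! i \<bullet>c ws ! i)) = ws ! i \<bullet>c ws ! i"
      by (simp add: less_eq_complex_def complex_eq_iff)
    moreover have "r i * r i = Re (ws ! i \<bullet>c ws ! i)"
      using ge unfolding r_def by (simp add: less_eq_complex_def)
    ultimately show "ws ! i \<bullet>c ws ! i = complex_of_real (r i) * r i"
      by (metis of_real_mult)
    with nz show "r i \<noteq> 0" by auto
  qed
  define U where "U = mat n n (\<lambda>(k, i). ws ! i $ k / complex_of_real (r i))"
  have U: "U \<in> carrier_mat n n" unfolding U_def by simp
  have "mat_adjoint U * U = 1\<^sub>m n"
  proof (rule eq_matI)
    fix i j assume "i < dim_row (1\<^sub>m n :: complex mat)" "j < dim_col (1\<^sub>m n :: complex mat)"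
    hence ij: "i < n" "j < n" by auto
    have "(mat_adjoint U * U) $$ (i, j) =
        (\<Sum>k = 0..<n. cnj (ws ! i $ k / complex_of_real (r i)) * (ws ! j $ k / complex_of_real (r j)))"
      using U ij by (simp add: scalar_prod_def U_def)
    also have "\<dots> = (\<Sum>k = 0..<n. ws ! j $ k * cnj (ws ! i $ k)) / (complex_of_real (r i) * r j)"
      unfolding sum_divide_distrib by (rule sum.cong) (auto simp: field_simps)
    also have "(\<Sum>k = 0..<n. ws ! j $ k * cnj (ws ! i $ k)) = ws ! j \<bullet>c ws ! i"
      using carrier_vecD[OF wsi[OF ij(1)]] carrier_vecD[OF wsi[OF ij(2)]]
      by (simp add: scalar_prod_def)
    also have "\<dots> / (complex_of_real (r i) * r j) = 1\<^sub>m n $$ (i, j)"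
    proof (cases "i = j")
      case True
      with r[OF ij(1)] ij show ?thesis by simp
    next
      case False
      hence "ws ! j \<bullet>c ws ! i = 0" using corthogonalD[OF ws(2), of j i] ws(3) ij by auto
      with False ij show ?thesis by simp
    qed
    finally show "(mat_adjoint U * U) $$ (i, j) = 1\<^sub>m n $$ (i, j)" .
  qed (use U in auto)
  moreover have "col U 0 = (1 / complex_of_real (r 0)) \<cdot>\<^sub>v v"
    using n v by (intro eq_vecI) (auto simp: U_def ws0)
  ultimately show ?thesis using unitary_matI[OF U] by blast
qed

text \<open>\<open>W\<close> is the block sum of the 1 by 1 identity and \<open>V\<close>. It
  carries a diagonalisation of the lower right block to the full matrix in the induction for
  \<open>normal_spectral\<close>.\<close>

lemma unitary_extend:
  assumes V: "unitary_mat n V"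
  defines "W \<equiv> mat (Suc n) (Suc n) (\<lambda>(i, j). if i = 0 \<or> j = 0 then (if i = j then 1 else 0)
     else V $$ (i - 1, j - 1))"
  shows "unitary_mat (Suc n) W"
proof (rule unitary_matI)
  show W: "W \<in> carrier_mat (Suc n) (Suc n)" unfolding W_def by simp
  have V': "V \<in> carrier_mat n n" using V by simp
  show "mat_adjoint W * W = 1\<^sub>m (Suc n)"
  proof (rule eq_matI)
    fix i j assume "i < dim_row (1\<^sub>m (Suc n) :: complex mat)" "j < dim_col (1\<^sub>m (Suc n) :: complex mat)"
    hence ij: "i < Suc n" "j < Suc n" by auto
    have "(mat_adjoint W * W) $$ (i, j) = (\<Sum>k = 0..<Suc n. cnj (W $$ (k, i)) * W $$ (k, j))"
      using W ij by (simp add: scalar_prod_def)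
    also have "\<dots> = cnj (W $$ (0, i)) * W $$ (0, j)
        + (\<Sum>k = 0..<n. cnj (W $$ (Suc k, i)) * W $$ (Suc k, j))"
      by (subst sum.atLeast0_lessThan_Suc_shift) simp
    also have "\<dots> = 1\<^sub>m (Suc n) $$ (i, j)"
    proof (cases "i = 0 \<or> j = 0")
      case True
      thus ?thesis using ij by (auto simp: W_def intro!: sum.neutral)
    next
      case False
      then obtain i' j' where s: "i = Suc i'" "j = Suc j'" by (metis not0_implies_Suc)
      have "(\<Sum>k = 0..<n. cnj (W $$ (Suc k, i)) * W $$ (Suc k, j)) = (mat_adjoint V * V) $$ (i', j')"
        using V' ij s by (simp add: scalar_prod_def W_def)
      thus ?thesis using ij s V by (simp add: W_def unitary_mat_def)
    qed
    finally show "(mat_adjoint W * W) $$ (i, j) = 1\<^sub>m (Suc n) $$ (i, j)" .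
  qed (use W in auto)
qed

text \<open>Deflation: conjugating by a unitary whose first column is an eigenvector clears the
  first column below the diagonal, normality then clears the first row, and the remaining block is
  normal of smaller size.\<close>

theorem normal_spectral:
  assumes "A \<in> carrier_mat n n" "A * mat_adjoint A = mat_adjoint A * A"
  shows "\<exists>U f. unitary_mat n U \<and> A = udiag n U f"
  using assms
proof (induction n arbitrary: A)
  case 0
  have "unitary_mat 0 (1\<^sub>m 0)" by (rule unitary_matI) auto
  moreover have "A = udiag 0 (1\<^sub>m 0) f" for f
    using 0 carrier_matD[OF udiag_carrier[OF calculation, of f]] by (intro eq_matI) auto
  ultimately show ?case by blast
next
  case (Suc n)
  note A = Suc.prems(1) and nA = Suc.prems(2)
  obtain e where "eigenvalue A e" using spectrum_non_empty[OF A] unfolding spectrum_def by auto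
  then obtain v where v: "v \<in> carrier_vec (Suc n)" "v \<noteq> 0\<^sub>v (Suc n)" "A *\<^sub>v v = e \<cdot>\<^sub>v v"
    using A unfolding eigenvalue_def eigenvector_def by auto
  obtain U c where U: "unitary_mat (Suc n) U" and c: "col U 0 = c \<cdot>\<^sub>v v"
    using unitary_first_col[OF v(1,2)] by auto
  have U': "U \<in> carrier_mat (Suc n) (Suc n)" using U by simp
  define B where "B = mat_adjoint U * A * U"
  have B: "B \<in> carrier_mat (Suc n) (Suc n)"
    unfolding B_def using A U' by (meson mult_carrier_mat mat_adjoint_carrier)
  have AB: "A = U * B * mat_adjoint U"
    unfolding B_def using unitary_conj_inverse[OF U A] by simp
  have nB: "B * mat_adjoint B = mat_adjoint B * B"
    unfolding B_def using A
    by (simp add: mat_adjoint_unitary_conj[OF U A] unitary_conj_mult[OF U] nA)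
  have col0: "B $$ (i, 0) = (if i = 0 then e else 0)" if i: "i < Suc n" for i
  proof -
    have "col (A * U) 0 = A *\<^sub>v col U 0" using A U' by (intro col_mult2) auto
    also have "\<dots> = c \<cdot>\<^sub>v (e \<cdot>\<^sub>v v)" unfolding c using A v by (simp add: mult_mat_vec)
    also have "\<dots> = e \<cdot>\<^sub>v col U 0" unfolding c by (simp add: smult_smult_assoc mult.commute)
    finally have cAU: "col (A * U) 0 = e \<cdot>\<^sub>v col U 0" .
    have "B $$ (i, 0) = row (mat_adjoint U) i \<bullet> col (A * U) 0"
      unfolding B_def using A U' i
      by (simp add: assoc_mult_mat[of _ "Suc n" "Suc n" _ "Suc n" _ "Suc n"])
    also have "\<dots> = e * (row (mat_adjoint U) i \<bullet> col U 0)"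
      unfolding cAU using U' i by simp
    also have "row (mat_adjoint U) i \<bullet> col U 0 = (mat_adjoint U * U) $$ (i, 0)"
      using U' i by simp
    also have "e * \<dots> = (if i = 0 then e else 0)"
      using U i by (simp add: unitary_mat_def)
    finally show ?thesis .
  qed
  \<comment> \<open>Index 0 is split off both products, so that the first row and column of
    \<open>B\<close> are separated from the remaining block.\<close>
  have BBa: "(B * mat_adjoint B) $$ (i, j) = B $$ (i, 0) * cnj (B $$ (j, 0))
      + (\<Sum>k = 0..<n. B $$ (i, Suc k) * cnj (B $$ (j, Suc k)))" if "i < Suc n" "j < Suc n" for i j
    using B that by (simp add: scalar_prod_def sum.atLeast0_lessThan_Suc_shift del: sum.op_ivl_Suc)
  have BaB: "(mat_adjoint B * B) $$ (i, j) = cnj (B $$ (0, i)) * B $$ (0, j)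
      + (\<Sum>k = 0..<n. cnj (B $$ (Suc k, i)) * B $$ (Suc k, j))" if "i < Suc n" "j < Suc n" for i j
    using B that by (simp add: scalar_prod_def sum.atLeast0_lessThan_Suc_shift del: sum.op_ivl_Suc)
  \<comment> \<open>Comparing the (0,0) entries of the two products, |e|^2 cancels and the squared
    moduli of the rest of the first row sum to zero.\<close>
  have row0: "B $$ (0, Suc k) = 0" if k: "k < n" for k
  proof -
    have "(\<Sum>k = 0..<n. B $$ (0, Suc k) * cnj (B $$ (0, Suc k))) = 0"
      using BBa[of 0 0] BaB[of 0 0] nB by (simp add: col0 mult.commute)
    hence "complex_of_real (\<Sum>k = 0..<n. (cmod (B $$ (0, Suc k)))^2) = 0"
      by (simp only: of_real_sum complex_norm_square)
    hence "(\<Sum>k = 0..<n. (cmod (B $$ (0, Suc k)))^2) = 0"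
      using of_real_eq_0_iff by blast
    thus ?thesis using k by (simp add: sum_nonneg_eq_0_iff)
  qed
  define C where "C = mat n n (\<lambda>(i, j). B $$ (Suc i, Suc j))"
  have C: "C \<in> carrier_mat n n" unfolding C_def by simp
  have nC: "C * mat_adjoint C = mat_adjoint C * C"
  proof (rule eq_matI)
    fix i j assume "i < dim_row (mat_adjoint C * C)" "j < dim_col (mat_adjoint C * C)"
    hence ij: "i < n" "j < n" using C by auto
    have "(C * mat_adjoint C) $$ (i, j) = (B * mat_adjoint B) $$ (Suc i, Suc j)"
      using ij C by (simp add: BBa col0 scalar_prod_def C_def)
    also have "\<dots> = (mat_adjoint C * C) $$ (i, j)"
      unfolding nB using ij C by (simp add: BaB row0 scalar_prod_def C_def)
    finally show "(C * mat_adjoint C) $$ (i, j) = (mat_adjoint C * C) $$ (i, j)" .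
  qed (use C in auto)
  obtain V g where V: "unitary_mat n V" and Cg: "C = udiag n V g"
    using Suc.IH[OF C nC] by blast
  define W where "W = mat (Suc n) (Suc n) (\<lambda>(i, j). if i = 0 \<or> j = 0 then (if i = j then 1 else 0)
     else V $$ (i - 1, j - 1))"
  have W: "unitary_mat (Suc n) W" unfolding W_def by (rule unitary_extend[OF V])
  \<comment> \<open>\<open>case_nat\<close> puts \<open>e\<close> in front of \<open>g\<close>,
    matching the index shift in \<open>W\<close>.\<close>
  define f where "f = case_nat e g"
  have "B = udiag (Suc n) W f"
  proof (rule eq_matI)
    fix i j assume "i < dim_row (udiag (Suc n) W f)" "j < dim_col (udiag (Suc n) W f)"
    hence ij: "i < Suc n" "j < Suc n" using carrier_matD[OF udiag_carrier[OF W, of f]] by auto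
    have "udiag (Suc n) W f $$ (i, j) = W $$ (i, 0) * e * cnj (W $$ (j, 0)) +
      (\<Sum>k = 0..<n. W $$ (i, Suc k) * g k * cnj (W $$ (j, Suc k)))"
      unfolding udiag_index[OF W ij]
      by (simp add: sum.atLeast0_lessThan_Suc_shift f_def del: sum.op_ivl_Suc)
    also have "\<dots> = B $$ (i, j)"
    proof (cases i)
      case 0
      thus ?thesis using ij by (cases j) (auto simp: W_def col0 row0)
    next
      case i: (Suc i')
      show ?thesis
      proof (cases j)
        case 0
        thus ?thesis using ij i by (auto simp: W_def col0)
      next
        case j: (Suc j')
        have "(\<Sum>k = 0..<n. W $$ (i, Suc k) * g k * cnj (W $$ (j, Suc k))) = C $$ (i', j')"
          unfolding Cg using ij i j by (simp add: udiag_index[OF V] W_def)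
        thus ?thesis using ij i j by (simp add: W_def C_def)
      qed
    qed
    finally show "B $$ (i, j) = udiag (Suc n) W f $$ (i, j)" by simp
  qed (use B carrier_matD[OF udiag_carrier[OF W, of f]] in auto)
  hence "A = udiag (Suc n) (U * W) f" using AB udiag_udiag[OF U W] by simp
  thus ?case using unitary_mult[OF U W] by blast
qed

text \<open>Column \<open>i\<close> of \<open>U\<close> is an eigenvector for \<open>f i\<close>; it
  is nonzero because the diagonal entries of \<open>mat_adjoint U * U\<close> are 1. This lets the
  spread bound the distances between the values of \<open>f\<close>.\<close>

lemma udiag_spectrum:
  assumes U: "unitary_mat n U" and i: "i < n"
  shows "f i \<in> spectrum (udiag n U f)"
proof -
  let ?A = "udiag n U f"
  have U': "U \<in> carrier_mat n n" and A: "?A \<in> carrier_mat n n" using U by auto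
  have "?A * U = U * (mat_diag n f * (mat_adjoint U * U))"
    using U' unfolding udiag_def
    by (simp add: assoc_mult_mat[of _ n n _ n _ n] mult_carrier_mat[of _ n n _ n])
  hence AU: "?A * U = U * mat_diag n f"
    using U by (simp add: unitary_mat_def right_mult_one_mat[of _ n n])
  have "?A *\<^sub>v col U i = col (?A * U) i" by (rule col_mult2[OF A U' i, symmetric])
  also have "\<dots> = f i \<cdot>\<^sub>v col U i"
    unfolding AU using U' i
    by (intro eq_vecI) (auto simp: mat_diag_mult_right[of _ n n] mult.commute)
  finally have "?A *\<^sub>v col U i = f i \<cdot>\<^sub>v col U i" .
  moreover have "col U i \<noteq> 0\<^sub>v n"
  proof
    assume "col U i = 0\<^sub>v n"
    moreover have "(mat_adjoint U * U) $$ (i, i) = row (mat_adjoint U) i \<bullet> col U i"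
      using U' i by simp
    ultimately have "(mat_adjoint U * U) $$ (i, i) = 0"
      using U' i by simp
    thus False using U i by (simp add: unitary_mat_def)
  qed
  moreover have "col U i \<in> carrier_vec n" using U' i by auto
  ultimately have "eigenvector ?A (col U i) (f i)"
    using A unfolding eigenvector_def by auto
  thus ?thesis unfolding spectrum_def eigenvalue_def by auto
qed

lemma spread_ge:
  assumes A: "A \<in> carrier_mat n n" and "x \<in> spectrum A" "y \<in> spectrum A"
  shows "cmod (x - y) \<le> spread A"
proof -
  \<comment> \<open>\<open>Max\<close> is meaningful only on a finite set; finiteness is inherited
    from the spectrum through this image.\<close>
  have "{cmod (x - y) | x y. x \<in> spectrum A \<and> y \<in> spectrum A}
      = (\<lambda>(x, y). cmod (x - y)) ` (spectrum A \<times> spectrum A)" by auto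
  hence "finite {cmod (x - y) | x y. x \<in> spectrum A \<and> y \<in> spectrum A}"
    using card_finite_spectrum(1)[OF A] by simp
  thus ?thesis unfolding spread_def using assms by (intro Max_ge) auto
qed

section \<open>Positive semidefinite matrices and square roots\<close>

text \<open>The diagonal entry is the quadratic form of \<open>P\<close> at column \<open>i\<close>
  of \<open>U\<close>. This gives both the nonnegative eigenvalues of \<open>P\<close> and, for a
  density matrix, nonnegative weights.\<close>

lemma psd_conj_diag_nonneg:
  assumes P: "psd_mat P" "P \<in> carrier_mat n n" and U: "unitary_mat n U" and i: "i < n"
  shows "0 \<le> (mat_adjoint U * P * U) $$ (i, i)"
proof -
  have U': "U \<in> carrier_mat n n" and ci: "col U i \<in> carrier_vec n"
    using unitary_mat_carrier[OF U] i by auto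
  have "row (mat_adjoint U) i = conjugate (col U i)"
    using U' i by (intro eq_vecI) auto
  moreover have "(mat_adjoint U * P * U) $$ (i, i) = row (mat_adjoint U) i \<bullet> col (P * U) i"
    using U' P i by (simp add: assoc_mult_mat[of _ n n _ n _ n])
  ultimately have "(mat_adjoint U * P * U) $$ (i, i) = conjugate (col U i) \<bullet> (P *\<^sub>v col U i)"
    by (simp only: col_mult2[OF P(2) U' i])
  also have "\<dots> = (P *\<^sub>v col U i) \<bullet>c col U i"
    using P ci by (intro comm_scalar_prod[of _ n]) auto
  finally show ?thesis using P ci unfolding psd_mat_def by auto
qed

lemma adjoint_inner:
  fixes A :: "complex mat"
  assumes A: "A \<in> carrier_mat n m" and v: "v \<in> carrier_vec m" and w: "w \<in> carrier_vec n"
  shows "(A *\<^sub>v v) \<bullet>c w = v \<bullet>c (mat_adjoint A *\<^sub>v w)"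
proof -
  have "(A *\<^sub>v v) \<bullet>c w = (\<Sum>i = 0..<n. \<Sum>j = 0..<m. A $$ (i, j) * v $ j * cnj (w $ i))"
    using A v w by (simp add: scalar_prod_def sum_distrib_right)
  also have "\<dots> = (\<Sum>j = 0..<m. \<Sum>i = 0..<n. A $$ (i, j) * v $ j * cnj (w $ i))"
    by (rule sum.swap)
  also have "\<dots> = v \<bullet>c (mat_adjoint A *\<^sub>v w)"
    using A v w by (simp add: scalar_prod_def sum_distrib_left algebra_simps)
  finally show ?thesis .
qed

text \<open>The matrix is the square of a Hermitian \<open>X\<close>, built from the square roots of
  \<open>f\<close>, so its quadratic form at \<open>v\<close> is the squared norm of
  \<open>X v\<close>.\<close>

lemma psd_udiag:
  assumes U: "unitary_mat n U" and f: "\<And>i. 0 \<le> f i"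
  shows "psd_mat (udiag n U (\<lambda>i. complex_of_real (f i)))" (is "psd_mat ?P")
proof -
  have P: "?P \<in> carrier_mat n n" using U by simp
  have adj: "mat_adjoint ?P = ?P" using mat_adjoint_udiag[OF U] by simp
  define X where "X = udiag n U (\<lambda>i. complex_of_real (sqrt (f i)))"
  have X: "X \<in> carrier_mat n n" "mat_adjoint X = X"
    using U mat_adjoint_udiag[OF U] by (simp_all add: X_def)
  have XX: "X * X = ?P"
    unfolding X_def udiag_mult[OF U] using f by (simp flip: of_real_mult)
  have "0 \<le> (?P *\<^sub>v v) \<bullet>c v" if v: "v \<in> carrier_vec n" for v
  proof -
    have "(?P *\<^sub>v v) \<bullet>c v = (X *\<^sub>v (X *\<^sub>v v)) \<bullet>c v"
      unfolding XX[symmetric] using X v by (simp add: assoc_mult_mat_vec[of _ n n _ n])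
    also have "\<dots> = (X *\<^sub>v v) \<bullet>c (X *\<^sub>v v)"
      using X v by (subst adjoint_inner[of _ n n]) auto
    finally show ?thesis by (simp add: conjugate_square_ge_0_vec)
  qed
  thus ?thesis unfolding psd_mat_def hermitian_mat_def using P adj by auto
qed

lemma psd_spectral:
  assumes P: "psd_mat P" "P \<in> carrier_mat n n"
  shows "\<exists>U f. unitary_mat n U \<and> P = udiag n U (\<lambda>i. complex_of_real (f i)) \<and> (\<forall>i<n. 0 \<le> f i)"
proof -
  have "P * mat_adjoint P = mat_adjoint P * P"
    using P unfolding psd_mat_def hermitian_mat_def by simp
  then obtain U g where U: "unitary_mat n U" and Pg: "P = udiag n U g"
    using normal_spectral[OF P(2)] by blast
  have g: "0 \<le> g i" if "i < n" for i
    using psd_conj_diag_nonneg[OF P U that] that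
    unfolding Pg udiag_conj[OF U] by (simp add: mat_diag_def)
  \<comment> \<open>Nonnegativity, hence reality, of \<open>g i\<close> is known only for
    \<open>i < n\<close>, so the diagonal matrices are identified instead of the functions.\<close>
  hence "mat_diag n g = mat_diag n (\<lambda>i. complex_of_real (Re (g i)))"
    by (intro eq_matI) (auto simp: mat_diag_def less_eq_complex_def complex_eq_iff)
  hence "P = udiag n U (\<lambda>i. complex_of_real (Re (g i)))"
    unfolding Pg udiag_def by simp
  moreover have "\<forall>i<n. 0 \<le> Re (g i)" using g by (simp add: less_eq_complex_def)
  ultimately show ?thesis using U by (intro exI[of _ U] exI[of _ "\<lambda>i. Re (g i)"] conjI)
qed

text \<open>With \<open>P = U diag(f) U\<^sup>*\<close>, \<open>Q = V diag(g) V\<^sup>*\<close> and \<open>W = U\<^sup>* V\<close>, the hypothesis says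
  \<open>f\<^sub>i\<^sup>2 W\<^sub>i\<^sub>j = W\<^sub>i\<^sub>j g\<^sub>j\<^sup>2\<close>, which for nonnegative \<open>f\<close>, \<open>g\<close> forces \<open>f\<^sub>i W\<^sub>i\<^sub>j = W\<^sub>i\<^sub>j g\<^sub>j\<close>.\<close>

lemma psd_sqrt_unique:
  assumes P: "psd_mat P" "P \<in> carrier_mat n n" and Q: "psd_mat Q" "Q \<in> carrier_mat n n"
    and eq: "P * P = Q * Q"
  shows "P = Q"
proof -
  obtain U f where U: "unitary_mat n U" and Pf: "P = udiag n U (\<lambda>i. complex_of_real (f i))"
    and f: "\<forall>i<n. 0 \<le> f i" using psd_spectral[OF P] by blast
  obtain V g where V: "unitary_mat n V" and Qg: "Q = udiag n V (\<lambda>i. complex_of_real (g i))"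
    and g: "\<forall>i<n. 0 \<le> g i" using psd_spectral[OF Q] by blast
  define W where "W = mat_adjoint U * V"
  have W: "W \<in> carrier_mat n n" unfolding W_def using U V by (intro mult_carrier_mat[of _ n n]) auto
  \<comment> \<open>\<open>left\<close> and \<open>right\<close> hold for every \<open>h\<close>:
    they are applied to the squared eigenvalues in \<open>sq\<close> and to the eigenvalues
    themselves at the end.\<close>
  have left: "mat_adjoint U * udiag n U h * V = mat_diag n h * W" for h
  proof -
    have "mat_adjoint U * udiag n U h * V
        = mat_adjoint U * (U * (mat_diag n h * (mat_adjoint U * V)))"
      using U V unfolding udiag_def
      by (simp add: assoc_mult_mat[of _ n n _ n _ n] mult_carrier_mat[of _ n n _ n])
    also have "\<dots> = mat_diag n h * (mat_adjoint U * V)"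
      using U V by (intro unitary_cancel[of n _ _ n] mult_carrier_mat[of _ n n _ n]) auto
    finally show ?thesis unfolding W_def .
  qed
  have right: "mat_adjoint U * udiag n V h * V = W * mat_diag n h" for h
  proof -
    have "mat_adjoint U * udiag n V h * V
        = mat_adjoint U * (V * (mat_diag n h * (mat_adjoint V * V)))"
      using U V unfolding udiag_def
      by (simp add: assoc_mult_mat[of _ n n _ n _ n] mult_carrier_mat[of _ n n _ n])
    also have "\<dots> = mat_adjoint U * (V * mat_diag n h)"
      using V by (simp add: unitary_mat_def right_mult_one_mat[of _ n n])
    finally show ?thesis unfolding W_def
      using U V by (simp add: assoc_mult_mat[of _ n n _ n _ n])
  qed
  \<comment> \<open>Sending \<open>X\<close> to \<open>mat_adjoint U * X * V\<close> is injective,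
    so \<open>P\<close> and \<open>Q\<close> may be compared after this map.\<close>
  have cancel: "X = U * (mat_adjoint U * X * V) * mat_adjoint V" if X: "X \<in> carrier_mat n n" for X
  proof -
    have "U * (mat_adjoint U * X * V) * mat_adjoint V
        = U * (mat_adjoint U * (X * (V * mat_adjoint V)))"
      using U V X by (simp add: assoc_mult_mat[of _ n n _ n _ n] mult_carrier_mat[of _ n n _ n])
    thus ?thesis using V X unitary_cancel(2)[OF U X]
      by (simp add: unitary_mat_def right_mult_one_mat[of _ n n])
  qed
  have sq: "mat_diag n (\<lambda>i. complex_of_real (f i) * f i) * W
      = W * mat_diag n (\<lambda>i. complex_of_real (g i) * g i)"
    using eq unfolding Pf Qg udiag_mult[OF U] udiag_mult[OF V]
    by (simp only: left[symmetric] right[symmetric])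
  have "mat_diag n (\<lambda>i. complex_of_real (f i)) * W = W * mat_diag n (\<lambda>i. complex_of_real (g i))"
  proof (rule eq_matI)
    fix i j
    assume "i < dim_row (W * mat_diag n (\<lambda>i. complex_of_real (g i)))"
      "j < dim_col (W * mat_diag n (\<lambda>i. complex_of_real (g i)))"
    hence ij: "i < n" "j < n" using W by (auto simp: mat_diag_def)
    have "complex_of_real (f i) * f i * W $$ (i, j) = W $$ (i, j) * (complex_of_real (g j) * g j)"
      using arg_cong[OF sq, of "\<lambda>M. M $$ (i, j)"] ij
      by (simp add: mat_diag_mult_left[OF W] mat_diag_mult_right[OF W])
    hence "W $$ (i, j) = 0 \<or> complex_of_real (f i * f i) = complex_of_real (g j * g j)"
      by (auto simp: mult.commute)
    hence "W $$ (i, j) = 0 \<or> f i * f i = g j * g j"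
      using of_real_eq_iff by blast
    moreover have "f i = g j" if "f i * f i = g j * g j"
      using that f g ij by (metis abs_of_nonneg real_sqrt_abs2)
    ultimately have "complex_of_real (f i) * W $$ (i, j) = W $$ (i, j) * complex_of_real (g j)"
      by auto
    thus "(mat_diag n (\<lambda>i. complex_of_real (f i)) * W) $$ (i, j)
        = (W * mat_diag n (\<lambda>i. complex_of_real (g i))) $$ (i, j)"
      using ij by (simp add: mat_diag_mult_left[OF W] mat_diag_mult_right[OF W])
  qed (use W in \<open>auto simp: mat_diag_def\<close>)
  hence "mat_adjoint U * P * V = mat_adjoint U * Q * V"
    unfolding Pf Qg left right .
  thus ?thesis using cancel[OF P(2)] cancel[OF Q(2)] by simp
qed

lemma mat_sqrt_eq:
  assumes P: "psd_mat P" "P \<in> carrier_mat n n"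
  shows "mat_sqrt (P * P) = P"
  unfolding mat_sqrt_def
proof (rule the_equality)
  fix Q assume Q: "psd_mat Q \<and> Q * Q = P * P"
  \<comment> \<open>The description in \<open>mat_sqrt\<close> fixes no dimension. A competing root
    is square because it is Hermitian, and its size is read off from \<open>Q * Q\<close>.\<close>
  hence sq: "square_mat Q" unfolding psd_mat_def hermitian_mat_def by simp
  have "dim_row (Q * Q) = n" using Q P(2) by simp
  hence "Q \<in> carrier_mat n n" using sq by auto
  thus "Q = P" using psd_sqrt_unique[of Q n P] Q P by auto
qed (use P in simp)

text \<open>The adjoint times the matrix has diagonal values |f|^2, which is the square of the
  positive semidefinite matrix with values |f|; uniqueness of the root finishes.\<close>

lemma mat_abs_udiag:
  assumes U: "unitary_mat n U"
  shows "mat_abs (udiag n U f) = udiag n U (\<lambda>i. complex_of_real (cmod (f i)))"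
proof -
  have "mat_adjoint (udiag n U f) * udiag n U f
      = udiag n U (\<lambda>i. complex_of_real (cmod (f i)) * complex_of_real (cmod (f i)))"
    unfolding mat_adjoint_udiag[OF U] udiag_mult[OF U]
    by (simp add: complex_norm_square[symmetric] power2_eq_square[symmetric] mult.commute)
  thus ?thesis unfolding mat_abs_def udiag_mult[OF U, symmetric]
    using mat_sqrt_eq[OF psd_udiag[OF U] udiag_carrier[OF U]] by simp
qed

section \<open>The trace inequality\<close>

lemma mat_trace_comm:
  fixes A B :: "complex mat"
  assumes A: "A \<in> carrier_mat n m" and B: "B \<in> carrier_mat m n"
  shows "mat_trace (A * B) = mat_trace (B * A)"
proof -
  have "mat_trace (A * B) = (\<Sum>i<n. \<Sum>k = 0..<m. A $$ (i, k) * B $$ (k, i))"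
    using A B by (simp add: mat_trace_def scalar_prod_def)
  also have "\<dots> = (\<Sum>k = 0..<m. \<Sum>i<n. A $$ (i, k) * B $$ (k, i))" by (rule sum.swap)
  also have "\<dots> = mat_trace (B * A)"
    using A B by (simp add: mat_trace_def scalar_prod_def mult.commute atLeast0LessThan)
  finally show ?thesis .
qed

text \<open>Cyclicity moves \<open>mat_adjoint U\<close> to the front, and against a diagonal factor
  only the diagonal of the conjugated \<open>D\<close> contributes. These entries become the
  probability weights.\<close>

lemma mat_trace_mult_udiag:
  assumes U: "unitary_mat n U" and D: "D \<in> carrier_mat n n"
  shows "mat_trace (D * udiag n U f) = (\<Sum>i<n. (mat_adjoint U * D * U) $$ (i, i) * f i)"
proof -
  have U': "U \<in> carrier_mat n n" using U by simp
  have M: "mat_adjoint U * D * U \<in> carrier_mat n n"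
    using U' D by (intro mult_carrier_mat[of _ n n]) auto
  have "mat_trace (D * udiag n U f) = mat_trace ((D * U * mat_diag n f) * mat_adjoint U)"
    using U' D unfolding udiag_def
    by (simp add: assoc_mult_mat[of _ n n _ n _ n] mult_carrier_mat[of _ n n _ n])
  also have "\<dots> = mat_trace (mat_adjoint U * (D * U * mat_diag n f))"
    using U' D by (intro mat_trace_comm[of _ n n] mult_carrier_mat[of _ n n]) auto
  also have "mat_adjoint U * (D * U * mat_diag n f) = (mat_adjoint U * D * U) * mat_diag n f"
    using U' D by (simp add: assoc_mult_mat[of _ n n _ n _ n] mult_carrier_mat[of _ n n _ n])
  also have "mat_trace \<dots> = (\<Sum>i<n. (mat_adjoint U * D * U) $$ (i, i) * f i)"
    unfolding mat_diag_mult_right[OF M] by (simp add: mat_trace_def)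
  finally show ?thesis .
qed

theorem corollary1:
  fixes n :: nat and A D :: "complex mat"
  assumes "n \<ge> 1"
    and "A \<in> carrier_mat n n" and "normal_mat A"
    and "D \<in> carrier_mat n n" and "density_mat D"
  shows "mat_trace (D * mat_abs (A - mat_trace (D * A) \<cdot>\<^sub>m 1\<^sub>m n) ^\<^sub>m 4)
           \<le> complex_of_real (4 / 27 * spread A ^ 4)
       \<and> (hermitian_mat A \<longrightarrow>
           mat_trace (D * mat_abs (A - mat_trace (D * A) \<cdot>\<^sub>m 1\<^sub>m n) ^\<^sub>m 4)
           \<le> complex_of_real (spread A ^ 4 / 12))"
proof -
  note A = assms(2) and D = assms(4)
  obtain U z where U: "unitary_mat n U" and Az: "A = udiag n U z"
    using normal_spectral[OF A] assms(3) unfolding normal_mat_def by blast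
  define p where "p i = Re ((mat_adjoint U * D * U) $$ (i, i))" for i
  have psd: "psd_mat D" and tr: "mat_trace D = 1" using assms(5) by (auto simp: density_mat_def)
  have nn: "0 \<le> (mat_adjoint U * D * U) $$ (i, i)" if "i < n" for i
    using psd_conj_diag_nonneg[OF psd D U that] .
  have p0: "0 \<le> p i" if "i < n" for i
    using nn[OF that] by (simp add: p_def less_eq_complex_def)
  \<comment> \<open>The trace against \<open>D\<close> is the expectation under \<open>p\<close>.
    Taking \<open>f\<close> to be 1, \<open>z\<close> and the fourth power of |z - \<mu>| gives the
    total mass, the mean and the fourth moment.\<close>
  have trace: "mat_trace (D * udiag n U f) = (\<Sum>i<n. complex_of_real (p i) * f i)" for f
    unfolding mat_trace_mult_udiag[OF U D]
    by (rule sum.cong) (use nn in \<open>auto simp: p_def less_eq_complex_def complex_eq_iff\<close>)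
  have "1 \<cdot>\<^sub>m 1\<^sub>m n = (1\<^sub>m n :: complex mat)" by (rule eq_matI) auto
  hence "complex_of_real (\<Sum>i<n. p i) = 1"
    using trace[of "\<lambda>_. 1"] tr D by (simp add: udiag_const[OF U])
  hence p1: "(\<Sum>i<n. p i) = 1" using of_real_eq_1_iff by blast
  define \<mu> where "\<mu> = (\<Sum>i<n. complex_of_real (p i) * z i)"
  \<comment> \<open>The scalar matrix is written as a constant \<open>udiag\<close> over the same
    \<open>U\<close>, so that centring, absolute value and fourth power all act on diagonal
    values.\<close>
  have "A - mat_trace (D * A) \<cdot>\<^sub>m 1\<^sub>m n = udiag n U (\<lambda>i. z i - \<mu>)"
    unfolding Az trace \<mu>_def[symmetric] udiag_const[OF U, symmetric] udiag_diff[OF U] ..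
  hence moment: "mat_trace (D * mat_abs (A - mat_trace (D * A) \<cdot>\<^sub>m 1\<^sub>m n) ^\<^sub>m 4)
      = complex_of_real (\<Sum>i<n. p i * cmod (z i - \<mu>) ^ 4)"
    by (simp add: mat_abs_udiag[OF U] udiag_pow[OF U] trace)
  have d: "cmod (z i - z j) \<le> spread A" if "i < n" "j < n" for i j
    using spread_ge[OF A] udiag_spectrum[OF U] that unfolding Az by blast
  have "(\<Sum>i<n. p i * cmod (z i - \<mu>) ^ 4) \<le> spread A ^ 4 / 8"
    unfolding \<mu>_def by (rule complex_fourth_central_moment_le(1)) (use p0 p1 d in auto)
  \<comment> \<open>1/8 = 27/216 lies below 4/27 = 32/216, and the fourth power is
    nonnegative.\<close>
  also have "\<dots> \<le> 4 / 27 * spread A ^ 4" by simp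
  finally have normal: "(\<Sum>i<n. p i * cmod (z i - \<mu>) ^ 4) \<le> 4 / 27 * spread A ^ 4" .
  have hermitian: "(\<Sum>i<n. p i * cmod (z i - \<mu>) ^ 4) \<le> spread A ^ 4 / 12" if "hermitian_mat A"
  proof -
    \<comment> \<open>Conjugating back by \<open>U\<close> turns self-adjointness of
      \<open>A\<close> into reality of each \<open>z i\<close> with \<open>i < n\<close>.\<close>
    have "udiag n U (\<lambda>i. cnj (z i)) = udiag n U z"
      using that mat_adjoint_udiag[OF U, of z] unfolding Az hermitian_mat_def by simp
    hence eq: "mat_diag n (\<lambda>i. cnj (z i)) = mat_diag n z"
      using udiag_conj[OF U] by metis
    have "Im (z i) = 0" if "i < n" for i
      using arg_cong[OF eq, of "\<lambda>M. M $$ (i, i)"] that by (simp add: mat_diag_def complex_eq_iff)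
    thus ?thesis
      unfolding \<mu>_def by (intro complex_fourth_central_moment_le(2)) (use p0 p1 d in auto)
  qed
  \<comment> \<open>By \<open>moment\<close> the trace is a real number, so the order on complex
    numbers reduces to the real inequalities.\<close>
  show ?thesis unfolding moment
    using normal hermitian by (simp add: less_eq_complex_def)
qed

end
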